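(* Any online MA communication protocol $\mathcal P$ for the $(m,n)$-Sparse INDEX problem with error at most $1/3$ and $\mathrm{hcost}(\mathcal P)\ge\log n$ must satisfy $\mathrm{hcost}(\mathcal P)\cdot\mathrm{vcost}(\mathcal P)=\Omega(m\log(n/m))$.
   Context: $(m,n)$-Sparse INDEX: Alice holds $x\in\{0,1\}^n$ of Hamming weight at most $m$, Bob holds an index $\iota\in[n]$; the output is $x_\iota$. Online MA communication for $F:X\times Y\to\{0,1\}$: (1) Alice and Merlin see $x$; (2) Merlin, using a private random string $r_M$, sends Alice a help message $\mathfrak h_1(x,r_M)$; (3) Bob receives $y$; (4) Merlin sends Bob $\mathfrak h_2(x,y,r_M)$; (5) Alice sends Bob a message that may use a public random string $r_A$ (not known to Merlin when he sends his messages), and Bob outputs a bit. The protocol is $\delta_c$-complete and $\delta_s$-sound if there exist help functions such that: if $F(x,y)=1$ then $\Pr_{r_M,r_A}[\text{output}=0]\le\delta_c$; if $F(x,y)=0$ then for all help messages $\Pr_{r_A}[\text{output}=1]\le\delta_s$. The error is the least $\max\{\delta_s,\delta_c\}$. $\mathrm{hcost}(\mathcal P)=1+\max_{x,y,r_M}(|\mathfrak h_1|+|\mathfrak h_2|)$ and $\mathrm{vcost}(\mathcal P)$ is the maximum number of bits communicated between Alice and Bob. *)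

theory Defs
  imports "HOL-Probability.Probability"
begin

text \<open>
  Online Merlin--Arthur communication for \<open>F : X \<times> Y \<rightarrow> {0,1}\<close>, with \<open>'x\<close> and \<open>'y\<close> the types of the
  inputs of Alice and Bob. Who may depend on what is encoded in the types: the first help message
  does not see Bob's input, neither help message sees the public coins, Alice does not see
  the second help message, and Bob does not see the first. Random strings are drawn from
  arbitrary discrete distributions (uniform strings of a fixed length are a special case).
  The functions \<open>help1\<close>, \<open>help2\<close> of the honest Merlin belong to the protocol, since \<open>hcost\<close>
  refers to them.
\<close>

record ('x, 'y) online_MA =
  merlin_coins :: "bool list pmf"
  public_coins :: "bool list pmf"
  help1 :: "'x \<Rightarrow> bool list \<Rightarrow> bool list"
    \<comment> \<open>Alice's input, private random string of Merlin\<close>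
  help2 :: "'x \<Rightarrow> 'y \<Rightarrow> bool list \<Rightarrow> bool list"
    \<comment> \<open>both inputs, private random string of Merlin\<close>
  alice :: "'x \<Rightarrow> bool list \<Rightarrow> bool list \<Rightarrow> bool list"
    \<comment> \<open>Alice's input, first help message, public random string\<close>
  bob :: "'y \<Rightarrow> bool list \<Rightarrow> bool list \<Rightarrow> bool list \<Rightarrow> bool"
    \<comment> \<open>Bob's input, second help message, public random string, message of Alice\<close>

definition outcome ::
  "('x, 'y) online_MA \<Rightarrow> 'x \<Rightarrow> 'y \<Rightarrow> bool list \<Rightarrow> bool list \<Rightarrow> bool list \<Rightarrow> bool" where
  "outcome P x y h1 h2 rA = bob P y h2 rA (alice P x h1 rA)"

definition complete_MA ::
  "'x set \<Rightarrow> 'y set \<Rightarrow> ('x \<Rightarrow> 'y \<Rightarrow> bool) \<Rightarrow> real \<Rightarrow> ('x, 'y) online_MA \<Rightarrow> bool" where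
  "complete_MA X Y F \<delta> P \<longleftrightarrow>
     (\<forall>x\<in>X. \<forall>y\<in>Y. F x y \<longrightarrow>
        measure_pmf.prob (pair_pmf (merlin_coins P) (public_coins P))
          {(rM, rA). \<not> outcome P x y (help1 P x rM) (help2 P x y rM) rA} \<le> \<delta>)"

definition sound_MA ::
  "'x set \<Rightarrow> 'y set \<Rightarrow> ('x \<Rightarrow> 'y \<Rightarrow> bool) \<Rightarrow> real \<Rightarrow> ('x, 'y) online_MA \<Rightarrow> bool" where
  "sound_MA X Y F \<delta> P \<longleftrightarrow>
     (\<forall>x\<in>X. \<forall>y\<in>Y. \<not> F x y \<longrightarrow>
        (\<forall>h1 h2. measure_pmf.prob (public_coins P) {rA. outcome P x y h1 h2 rA} \<le> \<delta>))"

text \<open>The infimum is attained; see \<open>error_MA_le_iff\<close> below.\<close>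

definition error_MA ::
  "'x set \<Rightarrow> 'y set \<Rightarrow> ('x \<Rightarrow> 'y \<Rightarrow> bool) \<Rightarrow> ('x, 'y) online_MA \<Rightarrow> real" where
  "error_MA X Y F P =
     Inf {max \<delta>s \<delta>c | \<delta>s \<delta>c. 0 \<le> \<delta>s \<and> 0 \<le> \<delta>c \<and> sound_MA X Y F \<delta>s P \<and> complete_MA X Y F \<delta>c P}"

text \<open>Costs are \<open>enat\<close>-valued, so that an unbounded protocol has cost \<open>\<infinity>\<close>.\<close>

definition hcost :: "'x set \<Rightarrow> 'y set \<Rightarrow> ('x, 'y) online_MA \<Rightarrow> enat" where
  "hcost X Y P =
     1 + (SUP x\<in>X. SUP y\<in>Y. SUP rM\<in>set_pmf (merlin_coins P).
            enat (length (help1 P x rM) + length (help2 P x y rM)))"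

text \<open>The only communication between Alice and Bob is Alice's message; its length is maximised
  over all runs, including those with a dishonest Merlin.\<close>

definition vcost :: "'x set \<Rightarrow> ('x, 'y) online_MA \<Rightarrow> enat" where
  "vcost X P = (SUP x\<in>X. SUP h1. SUP rA\<in>set_pmf (public_coins P). enat (length (alice P x h1 rA)))"

definition sparse_inputs :: "nat \<Rightarrow> nat \<Rightarrow> bool list set" where
  "sparse_inputs m n = {x. length x = n \<and> count_list x True \<le> m}"

text \<open>Indices are counted from \<open>0\<close>: the index set is \<open>{..<n}\<close>.\<close>

definition INDEX :: "bool list \<Rightarrow> nat \<Rightarrow> bool" where
  "INDEX x i = x ! i"

lemma error_MA_le_iff:
  assumes "0 \<le> \<epsilon>"
  shows "error_MA X Y F P \<le> \<epsilon> \<longleftrightarrow> sound_MA X Y F \<epsilon> P \<and> complete_MA X Y F \<epsilon> P"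
proof -
  let ?S = "{max \<delta>s \<delta>c | \<delta>s \<delta>c. 0 \<le> \<delta>s \<and> 0 \<le> \<delta>c \<and> sound_MA X Y F \<delta>s P \<and> complete_MA X Y F \<delta>c P}"
  have bdd: "bdd_below ?S" by (rule bdd_belowI[of _ 0]) auto
  have "sound_MA X Y F 1 P" "complete_MA X Y F 1 P"
    by (auto simp: sound_MA_def complete_MA_def)
  hence "max 1 1 \<in> ?S" using zero_le_one by (intro CollectI exI[of _ 1]) simp
  hence ne: "?S \<noteq> {}" by blast
  show ?thesis
  proof
    assume "sound_MA X Y F \<epsilon> P \<and> complete_MA X Y F \<epsilon> P"
    hence "max \<epsilon> \<epsilon> \<in> ?S" using assms by (intro CollectI exI[of _ \<epsilon>]) simp
    from cInf_lower[OF this bdd] show "error_MA X Y F P \<le> \<epsilon>" by (simp add: error_MA_def)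
  next
    assume le: "error_MA X Y F P \<le> \<epsilon>"
    show "sound_MA X Y F \<epsilon> P \<and> complete_MA X Y F \<epsilon> P"
    proof -
      have *: "\<exists>a b. a \<le> \<epsilon> + e \<and> b \<le> \<epsilon> + e \<and> sound_MA X Y F a P \<and> complete_MA X Y F b P"
        if e: "e > 0" for e
      proof -
        have "Inf ?S < \<epsilon> + e" using le e by (simp add: error_MA_def)
        then obtain d where d: "d \<in> ?S" "d < \<epsilon> + e" using cInf_lessD[OF ne] by blast
        from d(1) obtain a b where "d = max a b" "sound_MA X Y F a P" "complete_MA X Y F b P"
          by blast
        with d(2) show ?thesis by (intro exI[of _ a] exI[of _ b]) simp
      qed
      have "sound_MA X Y F \<epsilon> P"
        unfolding sound_MA_def
      proof (intro ballI impI allI, rule field_le_epsilon)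
        fix x y h1 h2 and e :: real
        assume A: "x \<in> X" "y \<in> Y" "\<not> F x y" "0 < e"
        obtain a where a: "a \<le> \<epsilon> + e" "sound_MA X Y F a P" using *[OF A(4)] by blast
        from a(2) A have "measure_pmf.prob (public_coins P) {rA. outcome P x y h1 h2 rA} \<le> a"
          unfolding sound_MA_def by blast
        with a(1) show "measure_pmf.prob (public_coins P) {rA. outcome P x y h1 h2 rA} \<le> \<epsilon> + e"
          by linarith
      qed
      moreover have "complete_MA X Y F \<epsilon> P"
        unfolding complete_MA_def
      proof (intro ballI impI, rule field_le_epsilon)
        fix x y and e :: real
        assume A: "x \<in> X" "y \<in> Y" "F x y" "0 < e"
        let ?p = "measure_pmf.prob (pair_pmf (merlin_coins P) (public_coins P))
          {(rM, rA). \<not> outcome P x y (help1 P x rM) (help2 P x y rM) rA}"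
        obtain b where b: "b \<le> \<epsilon> + e" "complete_MA X Y F b P" using *[OF A(4)] by blast
        from b(2) A have "?p \<le> b" unfolding complete_MA_def by blast
        with b(1) show "?p \<le> \<epsilon> + e" by linarith
      qed
      ultimately show ?thesis ..
    qed
  qed
qed

end

theory Submission
  imports Defs
begin

text \<open>
  Repeating Alice's message \<open>T = O(hcost)\<close> times with fresh public coins and taking a majority vote
  makes the soundness error so small that Bob can dispense with the second help message by
  trying all of them, and can do so for every index at once: here \<open>n \<le> 2 ^ hcost\<close> is used in the
  union bound. From her \<open>T\<close> messages he thus reads off a set \<open>S\<close> of accepted indices that rarely
  contains a zero of \<open>x\<close> and contains each one of \<open>x\<close> with probability at least \<open>1 / 3\<close>. Merlin's
  coins do not depend on \<open>x\<close>, so all coins can be fixed such that, for a constant fraction of the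
  \<open>m\<close>-subsets \<open>A\<close> of \<open>{..<n}\<close>, Alice's messages determine some \<open>S \<subseteq> A\<close> with \<open>card S \<ge> m / 8\<close>. Such
  an \<open>S\<close> is contained in at most a fraction \<open>(m / n) ^ card S\<close> of all \<open>m\<close>-subsets, hence the
  messages take at least \<open>2 ^ \<Omega>(m log (n / m))\<close> values.
\<close>

section \<open>Counting subsets that contain a fixed set\<close>

text \<open>Raising \<open>s\<close> by one scales the left binomial by
  \<open>(m - s) / (n - s)\<close>, which is at most \<open>m / n\<close>; multiplying out keeps the
  induction in the natural numbers.\<close>

lemma binomial_diff_diff_le:
  assumes "s \<le> m" "m \<le> n"
  shows "(n - s choose (m - s)) * n ^ s \<le> (n choose m) * m ^ s"
  using assms(1)
proof (induction s)
  case (Suc s)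
  let ?a = "n - s choose (m - s)" and ?b = "n - Suc s choose (m - Suc s)"
  have pos: "0 < n - s" using Suc.prems assms(2) by simp
  have "(m - s) * ?a = (n - s) * ?b"
    using times_binomial_minus1_eq[of "m - s" "n - s"] Suc.prems by simp
  moreover have "n * (m - s) \<le> m * (n - s)"
    using assms(2) by (simp add: diff_mult_distrib2 mult.commute diff_le_mono2)
  ultimately have "(n - s) * (n * ?b) \<le> (n - s) * (m * ?a)"
    by (metis mult.assoc mult.left_commute mult_le_mono1)
  hence step: "n * ?b \<le> m * ?a" using pos by simp
  have "?b * n ^ Suc s = n * ?b * n ^ s" by simp
  also have "\<dots> \<le> m * ?a * n ^ s" using step by (rule mult_le_mono1)
  also have "\<dots> \<le> m * ((n choose m) * m ^ s)" using Suc by (simp add: mult.assoc)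
  finally show ?case by (simp add: ac_simps)
qed simp

lemma card_subsets_containing_le:
  assumes S: "S \<subseteq> N" and "finite N" "m \<le> card N"
  shows "card {A. A \<subseteq> N \<and> card A = m \<and> S \<subseteq> A} * card N ^ card S \<le> (card N choose m) * m ^ card S"
proof (cases "card S \<le> m")
  case True
  let ?B = "{B. B \<subseteq> N - S \<and> card B = m - card S}"
  have fin: "finite S" using S assms(2) finite_subset by blast
  have "card {A. A \<subseteq> N \<and> card A = m \<and> S \<subseteq> A} \<le> card ?B"
  proof (rule card_inj_on_le)
    show "inj_on (\<lambda>A. A - S) {A. A \<subseteq> N \<and> card A = m \<and> S \<subseteq> A}" by (auto simp: inj_on_def)
    show "(\<lambda>A. A - S) ` {A. A \<subseteq> N \<and> card A = m \<and> S \<subseteq> A} \<subseteq> ?B"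
      using fin by (auto simp: card_Diff_subset)
    show "finite ?B" using assms(2) by simp
  qed
  also have "\<dots> = card N - card S choose (m - card S)"
    using assms(2) S fin by (simp add: n_subsets card_Diff_subset)
  finally show ?thesis
    using binomial_diff_diff_le[OF True assms(3)] by (meson le_trans mult_le_mono1)
next
  case False
  have empty: "{A. A \<subseteq> N \<and> card A = m \<and> S \<subseteq> A} = {}"
    using False assms(2) by (auto dest: finite_subset card_mono)
  show ?thesis unfolding empty by simp
qed

text \<open>An incompressibility bound: a message that decodes to a large subset can serve only the
  few \<open>m\<close>-sets above it, so \<open>M\<close> must be large compared with
  \<open>G\<close>.\<close>

lemma card_family_le:
  fixes dec :: "'c \<Rightarrow> 'a set"
  assumes N: "finite N" "m \<le> card N" "1 \<le> m"
    and M: "finite M"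
    and G: "G \<subseteq> {A. A \<subseteq> N \<and> card A = m}"
    and enc: "\<And>A. A \<in> G \<Longrightarrow> \<exists>\<mu>\<in>M. dec \<mu> \<subseteq> A \<and> t \<le> real (card (dec \<mu>))"
  shows "real (card G) \<le> real (card M) * real (card N choose m) * (real m / real (card N)) powr t"
proof -
  let ?M = "{\<mu>\<in>M. dec \<mu> \<subseteq> N \<and> t \<le> real (card (dec \<mu>))}"
  let ?F = "\<lambda>\<mu>. {A. A \<subseteq> N \<and> card A = m \<and> dec \<mu> \<subseteq> A}"
  let ?q = "real m / real (card N)" and ?b = "real (card N choose m)"
  have q: "0 < ?q" "?q \<le> 1" using N by auto
  have F: "real (card (?F \<mu>)) \<le> ?b * ?q powr t" if "\<mu> \<in> ?M" for \<mu>
  proof -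
    have "real (card (?F \<mu>)) * real (card N) ^ card (dec \<mu>) \<le> ?b * real m ^ card (dec \<mu>)"
      using card_subsets_containing_le[of "dec \<mu>" N m] that N
      by (metis (mono_tags, lifting) mem_Collect_eq of_nat_le_iff of_nat_mult of_nat_power)
    hence "real (card (?F \<mu>)) \<le> ?b * ?q ^ card (dec \<mu>)"
      using N by (simp add: power_divide pos_le_divide_eq)
    also have "\<dots> = ?b * ?q powr real (card (dec \<mu>))" using q by (simp add: powr_realpow)
    also have "\<dots> \<le> ?b * ?q powr t"
      using q that by (intro mult_left_mono powr_mono') auto
    finally show ?thesis .
  qed
  have "G \<subseteq> (\<Union>\<mu>\<in>?M. ?F \<mu>)"
  proof
    fix A assume A: "A \<in> G"
    with enc obtain \<mu> where "\<mu> \<in> M" "dec \<mu> \<subseteq> A" "t \<le> real (card (dec \<mu>))" by blast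
    moreover have "A \<subseteq> N" "card A = m" using A G by auto
    ultimately show "A \<in> (\<Union>\<mu>\<in>?M. ?F \<mu>)" by blast
  qed
  hence "card G \<le> card (\<Union>\<mu>\<in>?M. ?F \<mu>)"
    using M N by (intro card_mono) auto
  also have "\<dots> \<le> (\<Sum>\<mu>\<in>?M. card (?F \<mu>))" using M by (intro card_UN_le) simp
  finally have "real (card G) \<le> (\<Sum>\<mu>\<in>?M. real (card (?F \<mu>)))"
    by (subst of_nat_sum[symmetric]) (rule of_nat_mono)
  also have "\<dots> \<le> real (card ?M) * (?b * ?q powr t)" using F by (rule sum_bounded_above)
  also have "\<dots> \<le> real (card M) * (?b * ?q powr t)"
    using M by (intro mult_right_mono) (auto intro!: card_mono)
  finally show ?thesis by (simp add: mult.assoc)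
qed

section \<open>Bit strings and repeated trials\<close>

lemma card_bool_lists_length_le: "card {xs::bool list. length xs \<le> n} \<le> 2 ^ Suc n"
proof -
  have "card {xs::bool list. length xs \<le> n} = (\<Sum>i\<le>n. 2 ^ i)"
    using card_lists_length_le[of "UNIV :: bool set" n] by (simp add: card_UNIV_bool)
  also have "\<dots> = 2 ^ Suc n - (1::nat)"
    using mask_eq_sum_exp_nat[of "Suc n"] by (simp add: atMost_def less_Suc_eq_le)
  finally show ?thesis by simp
qed

lemma finite_bool_lists_length_le: "finite {xs::bool list. length xs \<le> n}"
  using finite_lists_length_le[of "UNIV :: bool set" n] by simp

lemma integrable_pmf_bounded:
  fixes f :: "'a \<Rightarrow> real"
  assumes "\<And>x. \<bar>f x\<bar> \<le> B"
  shows "integrable (measure_pmf p) f"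
  using assms by (intro measure_pmf.integrable_const_bound[of _ B]) auto

text \<open>Averaging over \<open>p\<close>: this carries soundness for every fixed help message
  over to help that depends on Merlin's coins.\<close>

lemma prob_pair_pmf_le:
  assumes "\<And>a. a \<in> set_pmf p \<Longrightarrow> measure_pmf.prob q {b. (a, b) \<in> E} \<le> \<delta>" "0 \<le> \<delta>"
  shows "measure_pmf.prob (pair_pmf p q) E \<le> \<delta>"
proof -
  have "emeasure (pair_pmf p q) E = (\<integral>\<^sup>+a. emeasure q {b. (a, b) \<in> E} \<partial>p)"
    by (simp add: pair_pmf_def vimage_def flip: map_pmf_def)
  also have "\<dots> \<le> (\<integral>\<^sup>+a. ennreal \<delta> \<partial>p)"
    using assms by (intro nn_integral_mono_AE)
      (auto simp: AE_measure_pmf_iff measure_pmf.emeasure_eq_measure ennreal_leI)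
  also have "\<dots> = ennreal \<delta>" by simp
  finally show ?thesis using assms(2) by (simp add: measure_pmf.emeasure_eq_measure)
qed

text \<open>Markov's inequality for \<open>2 ^ X\<close>, where \<open>X\<close> is the number of hits: its expectation is a
  product of \<open>2 * k\<close> factors \<open>1 + prob q E \<le> 4 / 3\<close>.\<close>

lemma prob_majority_le:
  assumes "measure_pmf.prob q E \<le> 1 / 3"
  shows "measure_pmf.prob (Pi_pmf {..<2 * k} d (\<lambda>_. q)) {r. k \<le> card {t\<in>{..<2 * k}. r t \<in> E}} \<le> (8 / 9) ^ k"
proof -
  let ?Q = "Pi_pmf {..<2 * k} d (\<lambda>_. q)"
  let ?X = "\<lambda>r. card {t\<in>{..<2 * k}. r t \<in> E}"
  have X: "?X r \<le> 2 * k" for r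
    using card_mono[of "{..<2 * k}" "{t\<in>{..<2 * k}. r t \<in> E}"] by auto
  have pow: "2 ^ ?X r = (\<Prod>t\<in>{..<2 * k}. 1 + indicator E (r t) :: real)" for r
  proof -
    have "(\<Prod>t\<in>{..<2 * k}. 1 + indicator E (r t) :: real)
        = (\<Prod>t\<in>{..<2 * k}. if r t \<in> E then 2 else 1)"
      by (intro prod.cong) auto
    also have "\<dots> = (\<Prod>t\<in>{t\<in>{..<2 * k}. r t \<in> E}. 2)" by (subst prod.inter_filter) auto
    finally show ?thesis by simp
  qed
  have int: "integrable ?Q (\<lambda>r. 2 ^ ?X r :: real)"
    using X by (intro integrable_pmf_bounded[of _ "2 ^ (2 * k)"]) (auto intro!: power_increasing)
  have "2 ^ k * measure_pmf.prob ?Q {r. k \<le> ?X r}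
      = measure_pmf.expectation ?Q (\<lambda>r. 2 ^ k * indicator {r. k \<le> ?X r} r)" by simp
  also have "\<dots> \<le> measure_pmf.expectation ?Q (\<lambda>r. 2 ^ ?X r)"
    by (intro integral_mono int integrable_pmf_bounded[of _ "2 ^ k"])
      (auto simp: indicator_def intro!: power_increasing)
  also have "\<dots> = (\<Prod>t\<in>{..<2 * k}. measure_pmf.expectation q (\<lambda>v. 1 + indicator E v))"
    unfolding pow by (intro expectation_prod_Pi_pmf) (auto intro!: integrable_pmf_bounded[of _ 2] simp: indicator_def)
  also have "\<dots> = (1 + measure_pmf.prob q E) ^ (2 * k)"
    by (simp add: Bochner_Integration.integral_add integrable_pmf_bounded[of _ 1])
  also have "\<dots> \<le> (4 / 3) ^ (2 * k)" using assms by (intro power_mono) auto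
  \<comment> \<open>Two rounds contribute \<open>(4 / 3) ^ 2 = 2 * (8 / 9)\<close>; the factor
    \<open>2 ^ k\<close> is the threshold in Markov's inequality.\<close>
  also have "\<dots> = 2 ^ k * (8 / 9) ^ k" by (simp add: power_mult power2_eq_square flip: power_mult_distrib)
  finally show ?thesis by simp
qed

text \<open>All rounds share one \<open>a\<close>, so they are not independent and repetition need
  not amplify success; a first-moment argument still leaves a constant.\<close>

lemma prob_majority_ge:
  assumes E: "2 / 3 \<le> measure_pmf.prob (pair_pmf p q) E" and "0 < k"
  shows "1 / 3 \<le> measure_pmf.prob (pair_pmf p (Pi_pmf {..<2 * k} d (\<lambda>_. q)))
           {(a, r). k \<le> card {t\<in>{..<2 * k}. (a, r t) \<in> E}}"
proof -
  let ?Q = "pair_pmf p (Pi_pmf {..<2 * k} d (\<lambda>_. q))"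
  let ?X = "\<lambda>z. card {t\<in>{..<2 * k}. (fst z, snd z t) \<in> E}"
  let ?M = "{z. k \<le> ?X z}"
  have X: "?X z \<le> 2 * k" for z
    using card_mono[of "{..<2 * k}" "{t\<in>{..<2 * k}. (fst z, snd z t) \<in> E}"] by auto
  have sum: "real (?X z) = (\<Sum>t\<in>{..<2 * k}. indicator {z. (fst z, snd z t) \<in> E} z)" for z
    by (simp add: indicator_def sum.If_cases Int_def)
  have comp: "measure_pmf.prob ?Q {z. (fst z, snd z t) \<in> E} = measure_pmf.prob (pair_pmf p q) E"
    if "t < 2 * k" for t
  proof -
    have "pair_pmf p q = map_pmf (\<lambda>(a, r). (a, r t)) ?Q"
      using map_pair[of "\<lambda>a. a" "\<lambda>r. r t" p "Pi_pmf {..<2 * k} d (\<lambda>_. q)"] that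
      by (simp add: Pi_pmf_component map_pmf_ident)
    thus ?thesis by (simp add: vimage_def case_prod_unfold)
  qed
  have ind: "measure_pmf.expectation ?Q (\<lambda>z. real k + real k * indicator S z) = k + k * measure_pmf.prob ?Q S" for S
    by (subst Bochner_Integration.integral_add) (auto intro: integrable_pmf_bounded[of _ 1])
  have "2 * k * (2 / 3) \<le> (\<Sum>t\<in>{..<2 * k}. measure_pmf.prob ?Q {z. (fst z, snd z t) \<in> E})"
    using mult_left_mono[OF E, of "2 * k"] comp by simp
  also have "\<dots> = measure_pmf.expectation ?Q (\<lambda>z. real (?X z))"
    unfolding sum by (subst Bochner_Integration.integral_sum) (auto intro!: integrable_pmf_bounded[of _ 1] simp: indicator_def)
  \<comment> \<open>The count is at most \<open>k\<close> outside \<open>?M\<close> and at most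
    \<open>2 * k\<close> on it, while its mean is at least \<open>4 * k / 3\<close>.\<close>
  also have "\<dots> \<le> measure_pmf.expectation ?Q (\<lambda>z. real k + real k * indicator ?M z)"
  proof (intro integral_mono)
    show "integrable ?Q (\<lambda>z. real (?X z))"
      using X by (intro integrable_pmf_bounded[of _ "2 * k"]) (auto simp flip: of_nat_mult)
    show "integrable ?Q (\<lambda>z. real k + real k * indicator ?M z)"
      by (intro integrable_pmf_bounded[of _ "2 * k"]) (auto simp: indicator_def)
    show "real (?X z) \<le> real k + real k * indicator ?M z" for z
      using X[of z] by (auto simp: indicator_def)
  qed
  also have "\<dots> = k + k * measure_pmf.prob ?Q ?M"
    by (rule ind)
  finally have "real k * (1 / 3) \<le> real k * measure_pmf.prob ?Q ?M" by simp
  hence "1 / 3 \<le> measure_pmf.prob ?Q ?M" using \<open>0 < k\<close> by (subst (asm) mult_le_cancel_left_pos) auto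
  thus ?thesis by (simp add: case_prod_unfold)
qed

section \<open>Repetition of the protocol\<close>

text \<open>The indices which Bob accepts by majority vote, for some short second help message, when he
  sees public coins \<open>r t\<close> and message \<open>\<mu> t\<close> in round \<open>t < 2 * k\<close>. The bound \<open>h\<close> is \<open>hcost - 1\<close>.\<close>

definition accepted :: "('x, 'y) online_MA \<Rightarrow> 'y set \<Rightarrow> nat \<Rightarrow> nat \<Rightarrow> (nat \<Rightarrow> bool list) \<Rightarrow> (nat \<Rightarrow> bool list) \<Rightarrow> 'y set" where
  "accepted P Y h k r \<mu> =
     {y\<in>Y. \<exists>h2. length h2 \<le> h \<and> k \<le> card {t\<in>{..<2 * k}. bob P y h2 (r t) (\<mu> t)}}"

text \<open>Restricting to the \<open>2 * k\<close> rounds places transcripts with bounded messages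
  in a finite product \<open>\<Pi>\<^sub>E\<close>.\<close>

definition transcript :: "('x, 'y) online_MA \<Rightarrow> nat \<Rightarrow> 'x \<Rightarrow> bool list \<Rightarrow> (nat \<Rightarrow> bool list) \<Rightarrow> nat \<Rightarrow> bool list" where
  "transcript P k x h1 r = (\<lambda>t\<in>{..<2 * k}. alice P x h1 (r t))"

lemma mem_accepted_transcript:
  "y \<in> accepted P Y h k r (transcript P k x h1 r) \<longleftrightarrow>
     y \<in> Y \<and> (\<exists>h2. length h2 \<le> h \<and> k \<le> card {t\<in>{..<2 * k}. outcome P x y h1 h2 (r t)})"
proof -
  have "{t\<in>{..<2 * k}. bob P y h2 (r t) (transcript P k x h1 r t)}
      = {t\<in>{..<2 * k}. outcome P x y h1 h2 (r t)}" for h2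
    by (auto simp: transcript_def outcome_def)
  thus ?thesis by (simp add: accepted_def)
qed

text \<open>A union bound over the fewer than \<open>2 ^ Suc h\<close> second help messages;
  soundness and the majority bound apply to each fixed one.\<close>

lemma prob_accepted_le:
  assumes "sound_MA X Y F (1 / 3) P" "x \<in> X" "y \<in> Y" "\<not> F x y"
  shows "measure_pmf.prob (Pi_pmf {..<2 * k} d (\<lambda>_. public_coins P))
           {r. y \<in> accepted P Y h k r (transcript P k x h1 r)} \<le> 2 ^ Suc h * (8 / 9) ^ k"
proof -
  let ?Q = "Pi_pmf {..<2 * k} d (\<lambda>_. public_coins P)" and ?L = "{h2::bool list. length h2 \<le> h}"
  let ?E = "\<lambda>h2. {r. k \<le> card {t\<in>{..<2 * k}. r t \<in> {rA. outcome P x y h1 h2 rA}}}"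
  have fin: "finite ?L" by (rule finite_bool_lists_length_le)
  have E: "measure_pmf.prob ?Q (?E h2) \<le> (8 / 9) ^ k" for h2
    using assms unfolding sound_MA_def by (intro prob_majority_le) blast
  have "{r. y \<in> accepted P Y h k r (transcript P k x h1 r)} = (\<Union>h2\<in>?L. ?E h2)"
    using assms(3) by (auto simp: mem_accepted_transcript)
  hence "measure_pmf.prob ?Q {r. y \<in> accepted P Y h k r (transcript P k x h1 r)}
      \<le> (\<Sum>h2\<in>?L. measure_pmf.prob ?Q (?E h2))"
    using fin by (auto intro: measure_pmf.finite_measure_subadditive_finite)
  also have "\<dots> \<le> card ?L * (8 / 9) ^ k" using E by (rule sum_bounded_above)
  also have "\<dots> \<le> 2 ^ Suc h * (8 / 9) ^ k"
    using of_nat_mono[OF card_bool_lists_length_le[of h], where 'a = real]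
    by (intro mult_right_mono) auto
  finally show ?thesis .
qed

text \<open>The honest second help message, the same in all rounds, witnesses acceptance.\<close>

lemma prob_accepted_ge:
  assumes "complete_MA X Y F (1 / 3) P" "x \<in> X" "y \<in> Y" "F x y" "0 < k"
    and h: "\<And>rM. rM \<in> set_pmf (merlin_coins P) \<Longrightarrow> length (help2 P x y rM) \<le> h"
  shows "1 / 3 \<le> measure_pmf.prob (pair_pmf (merlin_coins P) (Pi_pmf {..<2 * k} d (\<lambda>_. public_coins P)))
           {(rM, r). y \<in> accepted P Y h k r (transcript P k x (help1 P x rM) r)}"
proof -
  let ?E = "{(rM, rA). outcome P x y (help1 P x rM) (help2 P x y rM) rA}"
  let ?Q = "pair_pmf (merlin_coins P) (public_coins P)"
  let ?R = "pair_pmf (merlin_coins P) (Pi_pmf {..<2 * k} d (\<lambda>_. public_coins P))"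
  have "- ?E = {(rM, rA). \<not> outcome P x y (help1 P x rM) (help2 P x y rM) rA}" by auto
  hence "measure_pmf.prob ?Q (- ?E) \<le> 1 / 3"
    using assms unfolding complete_MA_def by simp
  hence "2 / 3 \<le> measure_pmf.prob ?Q ?E"
    using measure_pmf.prob_compl[of ?E ?Q] by (simp add: Compl_eq_Diff_UNIV)
  from prob_majority_ge[OF this \<open>0 < k\<close>, of d]
  have "1 / 3 \<le> measure_pmf.prob ?R {(rM, r). k \<le> card {t\<in>{..<2 * k}. (rM, r t) \<in> ?E}}" .
  \<comment> \<open>The length bound on \<open>help2\<close> is given only on the support of
    \<open>merlin_coins P\<close>, hence monotonicity almost everywhere.\<close>
  also have "\<dots> \<le> measure_pmf.prob ?R {(rM, r). y \<in> accepted P Y h k r (transcript P k x (help1 P x rM) r)}"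
    using h assms(3)
    by (intro measure_pmf.finite_measure_mono_AE)
      (auto simp: AE_measure_pmf_iff mem_accepted_transcript)
  finally show ?thesis .
qed

section \<open>Sets as sparse inputs, and Alice's messages\<close>

definition char_list :: "nat \<Rightarrow> nat set \<Rightarrow> bool list" where
  "char_list n A = map (\<lambda>i. i \<in> A) [0..<n]"

lemma char_list_in_sparse_inputs:
  assumes "A \<subseteq> {..<n}" "card A \<le> m"
  shows "char_list n A \<in> sparse_inputs m n"
proof -
  have "count_list (char_list n A) True = length (filter (\<lambda>i. i \<in> A) [0..<n])"
    by (simp add: char_list_def count_list_eq_length_filter filter_map o_def)
  also have "\<dots> = card (set (filter (\<lambda>i. i \<in> A) [0..<n]))" by (intro distinct_card[symmetric]) simp
  also have "set (filter (\<lambda>i. i \<in> A) [0..<n]) = A" using assms(1) by auto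
  finally show ?thesis using assms(2) by (simp add: sparse_inputs_def char_list_def)
qed

lemma INDEX_char_list: "i < n \<Longrightarrow> INDEX (char_list n A) i \<longleftrightarrow> i \<in> A"
  by (simp add: INDEX_def char_list_def)

lemma length_alice_le_vcost:
  assumes "x \<in> X" "rA \<in> set_pmf (public_coins P)"
  shows "enat (length (alice P x h1 rA)) \<le> vcost X P"
  unfolding vcost_def
  using assms by (intro SUP_upper2[OF assms(1)] SUP_upper2[OF UNIV_I, of _ _ h1] SUP_upper)

text \<open>Needed for protocols with \<open>hcost = \<infinity>\<close>, since \<open>\<infinity> * 0 = 0\<close> in \<open>enat\<close>.\<close>

lemma alice_not_silent:
  assumes mn: "1 \<le> m" "m \<le> n"
    and sound: "sound_MA (sparse_inputs m n) {..<n} INDEX (1 / 3) P"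
    and complete: "complete_MA (sparse_inputs m n) {..<n} INDEX (1 / 3) P"
  shows "vcost (sparse_inputs m n) P \<noteq> 0"
proof
  let ?X = "sparse_inputs m n" and ?Q = "pair_pmf (merlin_coins P) (public_coins P)"
  let ?x = "char_list n {0}" and ?x' = "char_list n {}"
  assume "vcost ?X P = 0"
  hence silent: "alice P x h1 rA = []" if "x \<in> ?X" "rA \<in> set_pmf (public_coins P)" for x h1 rA
    using length_alice_le_vcost[OF that] by (simp add: zero_enat_def)
  have x: "?x \<in> ?X" "?x' \<in> ?X" "INDEX ?x 0" "\<not> INDEX ?x' 0" "(0::nat) \<in> {..<n}"
    using mn by (auto intro!: char_list_in_sparse_inputs simp: INDEX_char_list)
  let ?E = "{(rM, rA). outcome P ?x 0 (help1 P ?x rM) (help2 P ?x 0 rM) rA}"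
  \<comment> \<open>A silent Alice makes \<open>?x\<close> and \<open>?x'\<close> indistinguishable
    to Bob, so soundness for \<open>?x'\<close> limits acceptance on \<open>?x\<close>, against
    completeness.\<close>
  have "measure_pmf.prob (public_coins P) {rA. outcome P ?x 0 h1 h2 rA} \<le> 1 / 3" for h1 h2
  proof -
    have "measure_pmf.prob (public_coins P) {rA. outcome P ?x 0 h1 h2 rA}
        = measure_pmf.prob (public_coins P) {rA. outcome P ?x' 0 h1 h2 rA}"
      using silent x by (intro measure_pmf.finite_measure_eq_AE) (auto simp: AE_measure_pmf_iff outcome_def)
    also have "\<dots> \<le> 1 / 3" using sound x unfolding sound_MA_def by blast
    finally show ?thesis .
  qed
  hence "measure_pmf.prob ?Q ?E \<le> 1 / 3" by (intro prob_pair_pmf_le) auto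
  moreover have "measure_pmf.prob ?Q (- ?E) \<le> 1 / 3"
  proof -
    have "- ?E = {(rM, rA). \<not> outcome P ?x 0 (help1 P ?x rM) (help2 P ?x 0 rM) rA}" by auto
    thus ?thesis using complete x unfolding complete_MA_def by simp
  qed
  ultimately show False
    using measure_pmf.prob_compl[of ?E ?Q] by (simp add: Compl_eq_Diff_UNIV)
qed

section \<open>The tradeoff for finite costs\<close>

text \<open>Here \<open>h\<close> stands for \<open>hcost - 1\<close> and \<open>v\<close> for
  \<open>vcost\<close>: \<open>72 * Suc h\<close> messages of length at most \<open>v\<close> must
  reveal \<open>m / 8\<close> elements of a constant fraction of the
  \<open>m\<close>-subsets.\<close>

lemma sparse_index_tradeoff:
  assumes mn: "1 \<le> m" "m \<le> n" "n \<le> 2 ^ Suc h"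
    and sound: "sound_MA (sparse_inputs m n) {..<n} INDEX (1 / 3) P"
    and complete: "complete_MA (sparse_inputs m n) {..<n} INDEX (1 / 3) P"
    and h: "\<And>x y rM. x \<in> sparse_inputs m n \<Longrightarrow> y < n \<Longrightarrow> rM \<in> set_pmf (merlin_coins P) \<Longrightarrow>
              length (help2 P x y rM) \<le> h"
    and v: "\<And>x h1 rA. x \<in> sparse_inputs m n \<Longrightarrow> rA \<in> set_pmf (public_coins P) \<Longrightarrow>
              length (alice P x h1 rA) \<le> v"
  shows "real m / 8 * log 2 (real n / real m) \<le> 72 * real (Suc h) * real (Suc v) + 3"
proof -
  \<comment> \<open>The factor 36 ensures \<open>4 * (8 / 9) ^ 36 \<le> 1 / 16\<close>; the 4
    combines two union bounds of size \<open>2 ^ Suc h\<close>, over help messages and over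
    indices.\<close>
  define k where "k = 36 * Suc h"
  define Q where "Q = pair_pmf (merlin_coins P) (Pi_pmf {..<2 * k} [] (\<lambda>_. public_coins P))"
  define \<A> where "\<A> = {A. A \<subseteq> {..<n} \<and> card A = m}"
  define S where "S A z = accepted P {..<n} h k (snd z)
      (transcript P k (char_list n A) (help1 P (char_list n A) (fst z)) (snd z))" for A z
  \<comment> \<open>The penalty \<open>m\<close> makes \<open>g A z > 0\<close> force \<open>S A z \<subseteq> A\<close>, and then \<open>g A z = card (S A z)\<close>.\<close>
  define g where "g A z = (\<Sum>i\<in>A. indicator {z. i \<in> S A z} z) - real m * indicator {z. \<not> S A z \<subseteq> A} z" for A z
  have \<A>: "finite \<A>" "card \<A> = (n choose m)"
    by (simp_all add: \<A>_def n_subsets)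
  have pos: "0 < card \<A>" using \<A>(2) mn by simp
  have A: "finite A" "card A = m" "A \<subseteq> {..<n}" "char_list n A \<in> sparse_inputs m n" if "A \<in> \<A>" for A
    using that by (auto simp: \<A>_def intro: finite_subset char_list_in_sparse_inputs)

  have ones: "1 / 3 \<le> measure_pmf.prob Q {z. i \<in> S A z}" if "A \<in> \<A>" "i \<in> A" for A i
  proof -
    have i: "i < n" using A(3)[OF that(1)] that(2) by auto
    show ?thesis
      using prob_accepted_ge[OF complete A(4)[OF that(1)], of i k h "[]"] i that h A(4)
      by (auto simp: INDEX_char_list Q_def S_def k_def case_prod_unfold)
  qed

  have zeros: "measure_pmf.prob Q {z. \<not> S A z \<subseteq> A} \<le> 1 / 16" if "A \<in> \<A>" for A
  proof -
    have zero: "measure_pmf.prob Q {z. i \<in> S A z} \<le> 2 ^ Suc h * (8 / 9) ^ k" if i: "i \<in> {..<n} - A" for i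
      unfolding Q_def
    proof (rule prob_pair_pmf_le)
      fix rM
      show "measure_pmf.prob (Pi_pmf {..<2 * k} [] (\<lambda>_. public_coins P)) {r. (rM, r) \<in> {z. i \<in> S A z}}
          \<le> 2 ^ Suc h * (8 / 9) ^ k"
        using prob_accepted_le[OF sound A(4)[OF \<open>A \<in> \<A>\<close>], of i k "[]" h "help1 P (char_list n A) rM"] i
        by (simp add: INDEX_char_list S_def)
    qed simp
    have "{z. \<not> S A z \<subseteq> A} \<subseteq> (\<Union>i\<in>{..<n} - A. {z. i \<in> S A z})"
      by (auto simp: S_def accepted_def)
    hence "measure_pmf.prob Q {z. \<not> S A z \<subseteq> A} \<le> measure_pmf.prob Q (\<Union>i\<in>{..<n} - A. {z. i \<in> S A z})"
      by (intro measure_pmf.finite_measure_mono) auto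
    also have "\<dots> \<le> (\<Sum>i\<in>{..<n} - A. measure_pmf.prob Q {z. i \<in> S A z})"
      by (intro measure_pmf.finite_measure_subadditive_finite) auto
    also have "\<dots> \<le> real (card ({..<n} - A)) * (2 ^ Suc h * (8 / 9) ^ k)"
      using zero by (rule sum_bounded_above)
    also have "\<dots> \<le> 2 ^ Suc h * (2 ^ Suc h * (8 / 9) ^ k)"
    proof (intro mult_right_mono)
      have "card ({..<n} - A) \<le> 2 ^ Suc h"
        using card_mono[of "{..<n}" "{..<n} - A"] mn(3) by auto
      from of_nat_mono[OF this, where 'a = real] show "real (card ({..<n} - A)) \<le> 2 ^ Suc h" by simp
    qed simp
    also have "\<dots> = (2 * (2 * (8 / 9) ^ 36)) ^ Suc h"
      unfolding k_def power_mult power_mult_distrib ..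
    also have "\<dots> \<le> (1 / 16) ^ Suc h" by (intro power_mono) (auto simp: field_simps)
    also have "\<dots> \<le> 1 / 16" using power_decreasing[of 1 "Suc h" "1 / 16 :: real"] by simp
    finally show ?thesis .
  qed

  have g_le: "g A z \<le> real m" if "A \<in> \<A>" for A z
    using sum_bounded_above[of A "\<lambda>i. indicator {z. i \<in> S A z} z" "1::real"] A[OF that]
    by (auto simp: g_def indicator_def split: if_splits)
  have int: "integrable Q (indicator E :: _ \<Rightarrow> real)" for E
    by (intro integrable_pmf_bounded[of _ 1]) (simp add: indicator_def)
  have g_int: "integrable Q (g A)" for A
    unfolding g_def using int by (intro Bochner_Integration.integrable_diff Bochner_Integration.integrable_sum integrable_mult_right) auto
  have Eg: "real m / 3 - real m / 16 \<le> measure_pmf.expectation Q (g A)" if "A \<in> \<A>" for A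
  proof -
    have "measure_pmf.expectation Q (g A)
        = (\<Sum>i\<in>A. measure_pmf.prob Q {z. i \<in> S A z}) - m * measure_pmf.prob Q {z. \<not> S A z \<subseteq> A}"
      unfolding g_def using int by (subst Bochner_Integration.integral_diff) (auto simp: Bochner_Integration.integral_sum)
    moreover have "real m * (1 / 3) \<le> (\<Sum>i\<in>A. measure_pmf.prob Q {z. i \<in> S A z})"
      using sum_bounded_below[of A "1 / 3" "\<lambda>i. measure_pmf.prob Q {z. i \<in> S A z}"] ones that A(2)[OF that] by simp
    moreover have "m * measure_pmf.prob Q {z. \<not> S A z \<subseteq> A} \<le> m * (1 / 16)"
      using zeros[OF that] by (intro mult_left_mono) auto
    ultimately show ?thesis by simp
  qed

  \<comment> \<open>The law \<open>Q\<close> of the coins is the same for all \<open>A\<close>, and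
    \<open>m / 3 - m / 16 = 13 * m / 48\<close> exceeds \<open>m / 4\<close>; hence a single
    \<open>z\<close> is good on average over \<open>\<A>\<close>.\<close>
  obtain z where z: "z \<in> set_pmf Q" "real (card \<A>) * (real m / 4) < (\<Sum>A\<in>\<A>. g A z)"
  proof (rule ccontr)
    assume "\<not> thesis"
    with that have le: "\<forall>z\<in>set_pmf Q. (\<Sum>A\<in>\<A>. g A z) \<le> card \<A> * (real m / 4)" by force
    have "card \<A> * (real m / 3 - real m / 16) \<le> (\<Sum>A\<in>\<A>. measure_pmf.expectation Q (g A))"
      using Eg by (rule sum_bounded_below)
    also have "\<dots> = measure_pmf.expectation Q (\<lambda>z. \<Sum>A\<in>\<A>. g A z)"
      using g_int by (simp add: Bochner_Integration.integral_sum)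
    also have "\<dots> \<le> card \<A> * (real m / 4)"
      using le g_int by (intro measure_pmf.integral_le_const) (auto simp: AE_measure_pmf_iff)
    finally show False using pos mn by (simp add: mult_le_cancel_left)
  qed

  define G where "G = {A\<in>\<A>. real m / 8 \<le> g A z}"
  \<comment> \<open>Reverse Markov: as \<open>g A z \<le> m\<close>, an average above
    \<open>m / 4\<close> forces \<open>g A z \<ge> m / 8\<close> for at least an eighth of
    \<open>\<A>\<close>.\<close>
  have G: "real (card \<A>) / 8 \<le> card G"
  proof -
    have "(\<Sum>A\<in>\<A>. g A z) \<le> (\<Sum>A\<in>\<A>. real m / 8 + (if A \<in> G then real m else 0))"
    proof (rule sum_mono)
      fix A assume "A \<in> \<A>"
      with g_le[OF this, of z] show "g A z \<le> real m / 8 + (if A \<in> G then real m else 0)"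
        by (simp add: G_def)
    qed
    also have "\<dots> = card \<A> * (real m / 8) + real m * card (\<A> \<inter> G)"
      using \<A>(1) by (simp add: sum.distrib sum.If_cases Int_def)
    also have "\<A> \<inter> G = G" by (auto simp: G_def)
    finally have "real m * (card \<A> / 8) \<le> real m * card G" using z(2) by (simp add: algebra_simps)
    thus ?thesis using mn by (subst (asm) mult_le_cancel_left_pos) auto
  qed
  define M where "M = (\<Pi>\<^sub>E t\<in>{..<2 * k}. {a::bool list. length a \<le> v})"
  have "real (card G) \<le> real (card M) * real (card {..<n} choose m) * (real m / real (card {..<n})) powr (m / 8)"
  \<comment> \<open>With \<open>z\<close> fixed, the accepted set is a function of the transcript
    alone, so the transcripts are the messages to be counted.\<close>
  proof (rule card_family_le[where dec = "accepted P {..<n} h k (snd z)"])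
    show "finite M" unfolding M_def using finite_bool_lists_length_le by (intro finite_PiE) auto
    show "G \<subseteq> {A. A \<subseteq> {..<n} \<and> card A = m}" by (auto simp: G_def \<A>_def)
    fix B assume "B \<in> G"
    hence B: "B \<in> \<A>" and gB: "real m / 8 \<le> g B z" by (auto simp: G_def)
    let ?\<mu> = "transcript P k (char_list n B) (help1 P (char_list n B) (fst z)) (snd z)"
    have sub: "S B z \<subseteq> B"
    proof (rule ccontr)
      assume "\<not> S B z \<subseteq> B"
      hence "g B z \<le> 0"
        using sum_bounded_above[of B "\<lambda>i. indicator {z. i \<in> S B z} z" "1::real"] A[OF B]
        by (auto simp: g_def indicator_def)
      thus False using gB mn by simp
    qed
    have "(\<Sum>i\<in>B. indicator {z. i \<in> S B z} z) = real (card (B \<inter> S B z))"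
      using A(1)[OF B] by (simp add: indicator_def sum.If_cases Int_def)
    hence "g B z = card (S B z)" using sub by (simp add: g_def Int_absorb1)
    hence "accepted P {..<n} h k (snd z) ?\<mu> \<subseteq> B \<and> m / 8 \<le> card (accepted P {..<n} h k (snd z) ?\<mu>)"
      using sub gB by (simp add: S_def)
    moreover have "snd z t \<in> set_pmf (public_coins P)" if "t < 2 * k" for t
      using z(1) that by (auto simp: Q_def set_Pi_pmf PiE_dflt_def)
    hence "?\<mu> \<in> M" using v A(4)[OF B] by (auto simp: M_def transcript_def)
    ultimately show "\<exists>\<mu>\<in>M. accepted P {..<n} h k (snd z) \<mu> \<subseteq> B \<and> m / 8 \<le> card (accepted P {..<n} h k (snd z) \<mu>)"
      by blast
  qed (use mn in auto)
  also have "\<dots> = real (card M) * real (card \<A>) * (real m / n) powr (m / 8)" using \<A>(2) by simp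
  also have "\<dots> \<le> 2 ^ (72 * Suc h * Suc v) * real (card \<A>) * (real m / n) powr (m / 8)"
  proof (intro mult_right_mono)
    have "card M = card {a::bool list. length a \<le> v} ^ (2 * k)" by (simp add: M_def card_PiE)
    \<comment> \<open>The exponent is \<open>Suc v\<close> because messages of every length up to
      \<open>v\<close> are counted.\<close>
    also have "\<dots> \<le> (2 ^ Suc v) ^ (2 * k)" using card_bool_lists_length_le by (rule power_mono) simp
    also have "\<dots> = 2 ^ (72 * Suc h * Suc v)" by (simp add: k_def power_mult[symmetric] mult.commute del: power_Suc)
    finally show "real (card M) \<le> 2 ^ (72 * Suc h * Suc v)" by (metis of_nat_le_iff of_nat_power of_nat_numeral)
  qed auto
  finally have "card \<A> * (1 / 8) \<le> card \<A> * (2 ^ (72 * Suc h * Suc v) * (real m / n) powr (m / 8))"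
    using G by (simp add: mult.commute mult.left_commute)
  hence "1 / 8 \<le> 2 ^ (72 * Suc h * Suc v) * (real m / n) powr (m / 8)"
    using pos by (subst (asm) mult_le_cancel_left_pos) auto
  \<comment> \<open>The eighth lost in passing to \<open>G\<close> becomes the additive constant
    3.\<close>
  hence "log 2 (1 / 8) \<le> log 2 (2 ^ (72 * Suc h * Suc v) * (real m / n) powr (m / 8))"
    using mn by (subst log_le_cancel_iff) auto
  also have "\<dots> = 72 * real (Suc h) * real (Suc v) + m / 8 * log 2 (real m / n)"
    using mn by (simp add: log_mult log_powr log_nat_power algebra_simps)
  also have "log 2 (real m / n) = - log 2 (real n / m)" using mn by (simp add: log_divide)
  finally have "log 2 (1 / 8) + m / 8 * log 2 (real n / m) \<le> 72 * real (Suc h) * real (Suc v)" by simp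
  moreover have "log 2 (1 / 8 :: real) = - 3"
    using log_nat_power[of 2 2 3] by (simp add: log_divide)
  ultimately show ?thesis by simp
qed

section \<open>The lower bound for arbitrary costs\<close>

theorem theorem3p10:
  "\<exists>c::real. c > 0 \<and>
     (\<forall>m n. \<forall>P :: (bool list, nat) online_MA.
        1 \<le> m \<longrightarrow> m \<le> n \<longrightarrow>
        error_MA (sparse_inputs m n) {..<n} INDEX P \<le> 1 / 3 \<longrightarrow>
        ereal (log 2 (real n)) \<le> ereal_of_enat (hcost (sparse_inputs m n) {..<n} P) \<longrightarrow>
        ereal (c * (real m * log 2 (real n / real m)))
          \<le> ereal_of_enat (hcost (sparse_inputs m n) {..<n} P * vcost (sparse_inputs m n) P))"
proof (intro exI[of _ "1 / 1176"] conjI allI impI)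
  fix m n and P :: "(bool list, nat) online_MA"
  let ?X = "sparse_inputs m n"
  let ?H = "hcost ?X {..<n} P" and ?V = "vcost ?X P"
  assume mn: "1 \<le> m" "m \<le> n"
    and err: "error_MA ?X {..<n} INDEX P \<le> 1 / 3"
    and H: "ereal (log 2 (real n)) \<le> ereal_of_enat ?H"
  have sound: "sound_MA ?X {..<n} INDEX (1 / 3) P" and complete: "complete_MA ?X {..<n} INDEX (1 / 3) P"
    using err error_MA_le_iff[of "1 / 3"] by auto
  have V0: "?V \<noteq> 0" by (rule alice_not_silent[OF mn sound complete])
  have H0: "?H \<noteq> 0" by (simp add: hcost_def)
  show "ereal (1 / 1176 * (real m * log 2 (real n / real m))) \<le> ereal_of_enat (?H * ?V)"
  proof (cases "?H = \<infinity> \<or> ?V = \<infinity>")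
    case True
    hence "?H * ?V = \<infinity>" using V0 H0 by (auto simp: imult_is_infinity)
    thus ?thesis by simp
  next
    case False
    then obtain H' v where H': "?H = enat H'" and v: "?V = enat v" by auto
    then obtain h where h: "H' = Suc h" using H0 by (cases H') (auto simp: zero_enat_def)
    have v0: "1 \<le> v" using V0 v by (cases v) (auto simp: zero_enat_def)
    have "(SUP x\<in>?X. SUP y\<in>{..<n}. SUP rM\<in>set_pmf (merlin_coins P).
            enat (length (help1 P x rM) + length (help2 P x y rM))) = enat h" (is "?S = _")
      using H' h unfolding hcost_def by (cases ?S) (auto simp: one_enat_def)
    hence "enat (length (help1 P x rM) + length (help2 P x y rM)) \<le> enat h"
      if "x \<in> ?X" "y < n" "rM \<in> set_pmf (merlin_coins P)" for x y rM
      using that by (metis (no_types, lifting) SUP_upper2 lessThan_iff order_refl)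
    hence short: "length (help2 P x y rM) \<le> h"
      if "x \<in> ?X" "y < n" "rM \<in> set_pmf (merlin_coins P)" for x y rM
      using that by fastforce
    have msg: "length (alice P x h1 rA) \<le> v"
      if "x \<in> ?X" "rA \<in> set_pmf (public_coins P)" for x h1 rA
      using length_alice_le_vcost[OF that] v by simp
    have "log 2 (real n) \<le> real (Suc h)" using H H' h by simp
    hence "real n \<le> 2 powr real (Suc h)" using mn by (simp add: log_le_iff del: of_nat_Suc)
    hence "real n \<le> real (2 ^ Suc h)" by (simp add: powr_realpow del: of_nat_Suc)
    hence n: "n \<le> 2 ^ Suc h" by (simp only: of_nat_le_iff)
    have "real m / 8 * log 2 (real n / real m) \<le> 72 * real (Suc h) * real (Suc v) + 3"
      by (rule sparse_index_tradeoff[OF mn n sound complete short msg])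
    \<comment> \<open>From \<open>1 \<le> v\<close> follow \<open>Suc v \<le> 2 * v\<close> and
      \<open>1 \<le> Suc h * v\<close>; the coefficients add up to 147, and
      \<open>8 * 147 = 1176\<close>.\<close>
    also have "\<dots> \<le> 72 * real (Suc h) * (2 * real v) + 3 * (real (Suc h) * real v)"
    proof (intro add_mono mult_left_mono)
      have "1 \<le> Suc h * v" using v0 by (cases v) auto
      thus "3 \<le> 3 * (real (Suc h) * real v)"
        by (metis mult.right_neutral mult_left_mono of_nat_1 of_nat_le_iff of_nat_mult zero_le_numeral)
    qed (use v0 in auto)
    finally have "1 / 1176 * (real m * log 2 (real n / real m)) \<le> real (Suc h) * real v"
      by (simp add: algebra_simps)
    thus ?thesis using H' v h by (simp add: algebra_simps)
  qed
qed simp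

end
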